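(* $(\mathbf{M},E_0)$ is an effectively inseparable pair: there is a total computable $f:\mathbb{N}^2\to\mathbb{N}$ such that whenever $\mathbf{M}\subseteq W_i$, $E_0\subseteq W_j$ and $W_i\cap W_j=\varnothing$, then $f(i,j)\notin W_i\cup W_j$.
   Context: $(\varphi_e)_{e\in\mathbb{N}}$ is a fixed standard acceptable numbering of the unary partial computable functions and $W_e=\operatorname{dom}\varphi_e$. $\mathbf{M}=\{p\in\mathbb{N}:\varphi_p(0)\!\downarrow=1\}$ and $E_0=\{p\in\mathbb{N}:\varphi_p(0)\!\downarrow=0\}$. *)

theory Defs
  imports Main
begin

datatype recf =
    Zero
  | Succ
  | Proj nat
  | Comp recf "recf list"
  | PrimRec recf recf
  | Mu recf

text \<open>
  \<open>wf_recf n f\<close>: the expression \<open>f\<close> is a well-formed description of an \<open>n\<close>-ary function.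
  \<open>Zero\<close> denotes the constant zero function of every arity.
\<close>

fun wf_recf :: "nat \<Rightarrow> recf \<Rightarrow> bool" where
  "wf_recf n Zero \<longleftrightarrow> True"
| "wf_recf n Succ \<longleftrightarrow> n = 1"
| "wf_recf n (Proj i) \<longleftrightarrow> i < n"
| "wf_recf n (Comp f gs) \<longleftrightarrow> wf_recf (length gs) f \<and> (\<forall>g\<in>set gs. wf_recf n g)"
| "wf_recf n (PrimRec f g) \<longleftrightarrow> 0 < n \<and> wf_recf (n - 1) f \<and> wf_recf (n + 1) g"
| "wf_recf n (Mu f) \<longleftrightarrow> wf_recf (n + 1) f"

text \<open>
  Composition is strict. The recursion variable and the minimisation variable are the first
  argument, and the step function of a recursion receives the predecessor, the previous value
  and the parameters, in this order. Minimisation returns the least zero, provided that all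
  earlier values are defined. Argument lists of the wrong length are irrelevant, since
  \<open>partial_computable\<close> below only uses well-formed expressions.
\<close>

fun eval_recf :: "recf \<Rightarrow> nat list \<Rightarrow> nat option" where
  "eval_recf Zero xs = Some 0"
| "eval_recf Succ xs = Some (Suc (hd xs))"
| "eval_recf (Proj i) xs = Some (xs ! i)"
| "eval_recf (Comp f gs) xs =
     (if \<forall>g\<in>set gs. eval_recf g xs \<noteq> None
      then eval_recf f (map (\<lambda>g. the (eval_recf g xs)) gs)
      else None)"
| "eval_recf (PrimRec f g) xs =
     rec_nat (eval_recf f (tl xs))
       (\<lambda>k r. Option.bind r (\<lambda>y. eval_recf g (k # y # tl xs)))
       (hd xs)"
| "eval_recf (Mu f) xs =
     (if \<exists>n. eval_recf f (n # xs) = Some 0 \<and> (\<forall>m<n. eval_recf f (m # xs) \<noteq> None)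
      then Some (LEAST n. eval_recf f (n # xs) = Some 0)
      else None)"

definition partial_computable :: "nat \<Rightarrow> (nat list \<Rightarrow> nat option) \<Rightarrow> bool" where
  "partial_computable n F \<longleftrightarrow>
     (\<exists>f. wf_recf n f \<and> (\<forall>xs. length xs = n \<longrightarrow> eval_recf f xs = F xs))"

definition partial_computable1 :: "(nat \<Rightarrow> nat option) \<Rightarrow> bool" where
  "partial_computable1 \<psi> \<longleftrightarrow> partial_computable 1 (\<lambda>xs. \<psi> (xs ! 0))"

definition partial_computable2 :: "(nat \<Rightarrow> nat \<Rightarrow> nat option) \<Rightarrow> bool" where
  "partial_computable2 \<psi> \<longleftrightarrow> partial_computable 2 (\<lambda>xs. \<psi> (xs ! 0) (xs ! 1))"

definition total_computable1 :: "(nat \<Rightarrow> nat) \<Rightarrow> bool" where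
  "total_computable1 s \<longleftrightarrow> partial_computable1 (\<lambda>x. Some (s x))"

definition total_computable2 :: "(nat \<Rightarrow> nat \<Rightarrow> nat) \<Rightarrow> bool" where
  "total_computable2 f \<longleftrightarrow> partial_computable2 (\<lambda>x y. Some (f x y))"

text \<open>
  An acceptable numbering (Rogers) enumerates exactly the unary partial computable functions,
  has a partial computable universal function, and satisfies the s-m-n property.
\<close>

definition acceptable_numbering :: "(nat \<Rightarrow> nat \<Rightarrow> nat option) \<Rightarrow> bool" where
  "acceptable_numbering \<phi> \<longleftrightarrow>
     range \<phi> = {\<psi>. partial_computable1 \<psi>} \<and>
     partial_computable2 \<phi> \<and>
     (\<forall>\<psi>. partial_computable2 \<psi> \<longrightarrow>
        (\<exists>s. total_computable1 s \<and> (\<forall>x. \<phi> (s x) = \<psi> x)))"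

definition W :: "(nat \<Rightarrow> nat \<Rightarrow> nat option) \<Rightarrow> nat \<Rightarrow> nat set" where
  "W \<phi> e = dom (\<phi> e)"

definition M_set :: "(nat \<Rightarrow> nat \<Rightarrow> nat option) \<Rightarrow> nat set" where
  "M_set \<phi> = {p. \<phi> p 0 = Some 1}"

definition E0_set :: "(nat \<Rightarrow> nat \<Rightarrow> nat option) \<Rightarrow> nat set" where
  "E0_set \<phi> = {p. \<phi> p 0 = Some 0}"

definition effectively_inseparable ::
  "(nat \<Rightarrow> nat \<Rightarrow> nat option) \<Rightarrow> nat set \<Rightarrow> nat set \<Rightarrow> bool" where
  "effectively_inseparable \<phi> A B \<longleftrightarrow>
     (\<exists>f. total_computable2 f \<and>
        (\<forall>i j. A \<subseteq> W \<phi> i \<and> B \<subseteq> W \<phi> j \<and> W \<phi> i \<inter> W \<phi> j = {} \<longrightarrow>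
           f i j \<notin> W \<phi> i \<union> W \<phi> j))"

end

theory Submission
  imports Defs "HOL-Library.Nat_Bijection"
begin

text \<open>
  For indices \<open>i\<close>, \<open>j\<close> the recursion theorem yields, computably, a program \<open>p\<close> which on input \<open>0\<close>
  waits for \<open>p\<close> itself to appear in \<open>W\<^sub>i\<close> or \<open>W\<^sub>j\<close> and outputs \<open>0\<close> in the first and \<open>1\<close> in the second
  case. If \<open>p \<in> W\<^sub>i\<close> then \<open>p\<close> lies in \<open>E\<^sub>0 \<subseteq> W\<^sub>j\<close>, and if \<open>p \<in> W\<^sub>j\<close> then \<open>p\<close> lies in \<open>\<^bold>M \<subseteq> W\<^sub>i\<close>; both
  contradict disjointness. The parallel search needs only a step-bounded version of one
  fixed expression, the universal function, so no arithmetization of expressions is necessary: the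
  step-bounded evaluation of each expression is computable by structural induction.
\<close>

section \<open>Closure properties of the computable functions\<close>

definition tot_computable :: "nat \<Rightarrow> (nat list \<Rightarrow> nat) \<Rightarrow> bool" where
  "tot_computable n F \<longleftrightarrow> partial_computable n (\<lambda>xs. Some (F xs))"

text \<open>Argument lists are treated as one list-valued total function, so that substitution into
  an expression and passing on the block of parameters each become a single rule.\<close>

definition vec_computable :: "nat \<Rightarrow> nat \<Rightarrow> (nat list \<Rightarrow> nat list) \<Rightarrow> bool" where
  "vec_computable n m V \<longleftrightarrow>
     (\<forall>xs. length xs = n \<longrightarrow> length (V xs) = m) \<and> (\<forall>i<m. tot_computable n (\<lambda>xs. V xs ! i))"

lemma partial_computable_cong:
  assumes "partial_computable n F" "\<And>xs. length xs = n \<Longrightarrow> F xs = G xs"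
  shows "partial_computable n G"
  using assms by (auto simp: partial_computable_def)

lemma tot_computable_cong:
  assumes "tot_computable n F" "\<And>xs. length xs = n \<Longrightarrow> F xs = G xs"
  shows "tot_computable n G"
  using assms unfolding tot_computable_def by (auto intro: partial_computable_cong)

lemma tot_computable_nth: "i < n \<Longrightarrow> tot_computable n (\<lambda>xs. xs ! i)"
  unfolding tot_computable_def partial_computable_def by (rule exI[of _ "Proj i"]) simp

lemma vec_computableI:
  assumes "\<And>xs. length xs = n \<Longrightarrow> length (V xs) = m"
    and "\<And>i. i < m \<Longrightarrow> tot_computable n (\<lambda>xs. V xs ! i)"
  shows "vec_computable n m V"
  using assms by (auto simp: vec_computable_def)

lemma vec_computable_nth: "vec_computable n m V \<Longrightarrow> i < m \<Longrightarrow> tot_computable n (\<lambda>xs. V xs ! i)"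
  by (auto simp: vec_computable_def)

lemma vec_computable_id: "vec_computable n n (\<lambda>xs. xs)"
  by (auto intro: vec_computableI tot_computable_nth)

lemma vec_computable_Nil: "vec_computable n 0 (\<lambda>xs. [])"
  by (auto intro: vec_computableI)

lemma vec_computable_Cons:
  assumes "tot_computable n A" "vec_computable n m V"
  shows "vec_computable n (Suc m) (\<lambda>xs. A xs # V xs)"
proof (rule vec_computableI)
  fix i assume "i < Suc m"
  then show "tot_computable n (\<lambda>xs. (A xs # V xs) ! i)"
    using assms by (cases i) (auto simp: vec_computable_def)
qed (use assms in \<open>auto simp: vec_computable_def\<close>)

lemma vec_computable_single: "tot_computable n A \<Longrightarrow> vec_computable n 1 (\<lambda>xs. [A xs])"
  using vec_computable_Cons[OF _ vec_computable_Nil] by simp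

lemma vec_computable_drop:
  assumes "vec_computable n (k + m) V"
  shows "vec_computable n m (\<lambda>xs. drop k (V xs))"
proof (rule vec_computableI)
  fix i assume "i < m"
  then have "tot_computable n (\<lambda>xs. V xs ! (k + i))"
    using assms by (auto simp: vec_computable_def)
  then show "tot_computable n (\<lambda>xs. drop k (V xs) ! i)"
    by (rule tot_computable_cong) (use assms in \<open>auto simp: vec_computable_def\<close>)
qed (use assms in \<open>auto simp: vec_computable_def\<close>)

lemma vec_computable_tl:
  "vec_computable n (Suc m) V \<Longrightarrow> vec_computable n m (\<lambda>xs. tl (V xs))"
  using vec_computable_drop[of n 1 m V] by (simp add: drop_Suc)

lemma vec_computable_map:
  assumes "\<And>g. g \<in> set gs \<Longrightarrow> tot_computable n (H g)"
  shows "vec_computable n (length gs) (\<lambda>xs. map (\<lambda>g. H g xs) gs)"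
  using assms by (auto intro!: vec_computableI)

lemma vec_computable_recfs:
  assumes "vec_computable n m V"
  obtains gs where "length gs = m" "\<forall>g\<in>set gs. wf_recf n g"
    "\<And>xs g. length xs = n \<Longrightarrow> g \<in> set gs \<Longrightarrow> eval_recf g xs \<noteq> None"
    "\<And>xs. length xs = n \<Longrightarrow> map (\<lambda>g. the (eval_recf g xs)) gs = V xs"
proof -
  \<comment> \<open>The bound on \<open>i\<close> sits under the existential quantifier so that
    choice yields a function on all of the natural numbers.\<close>
  have "\<forall>i. \<exists>g. i < m \<longrightarrow>
      wf_recf n g \<and> (\<forall>xs. length xs = n \<longrightarrow> eval_recf g xs = Some (V xs ! i))"
    using assms by (auto simp: vec_computable_def tot_computable_def partial_computable_def)
  from choice[OF this] obtain g where wf: "\<And>i. i < m \<Longrightarrow> wf_recf n (g i)"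
    and eval: "\<And>i xs. i < m \<Longrightarrow> length xs = n \<Longrightarrow> eval_recf (g i) xs = Some (V xs ! i)"
    by blast
  have len: "length (V xs) = m" if "length xs = n" for xs
    using assms that by (auto simp: vec_computable_def)
  show thesis
  proof (rule that[of "map g [0..<m]"])
    show "map (\<lambda>g. the (eval_recf g xs)) (map g [0..<m]) = V xs" if "length xs = n" for xs
      by (rule nth_equalityI) (simp_all add: len eval that)
  qed (auto simp: wf eval)
qed

text \<open>The inner functions are total, so strictness of \<open>Comp\<close> costs nothing and
  only \<open>F\<close> can diverge.\<close>

lemma partial_computable_comp:
  assumes "partial_computable m F" "vec_computable n m V"
  shows "partial_computable n (\<lambda>xs. F (V xs))"
proof -
  obtain f where f: "wf_recf m f" "\<And>xs. length xs = m \<Longrightarrow> eval_recf f xs = F xs"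
    using assms(1) by (auto simp: partial_computable_def)
  obtain gs where gs: "length gs = m" "\<forall>g\<in>set gs. wf_recf n g"
    "\<And>xs g. length xs = n \<Longrightarrow> g \<in> set gs \<Longrightarrow> eval_recf g xs \<noteq> None"
    "\<And>xs. length xs = n \<Longrightarrow> map (\<lambda>g. the (eval_recf g xs)) gs = V xs"
    using vec_computable_recfs[OF assms(2)] by blast
  have "length (V xs) = m" if "length xs = n" for xs
    using assms(2) that by (auto simp: vec_computable_def)
  then show ?thesis
    unfolding partial_computable_def
    by (intro exI[of _ "Comp f gs"]) (use f gs in auto)
qed

lemma tot_computable_comp:
  assumes "tot_computable m F" "vec_computable n m V"
  shows "tot_computable n (\<lambda>xs. F (V xs))"
  using partial_computable_comp[OF assms(1)[unfolded tot_computable_def] assms(2)]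
  by (simp add: tot_computable_def)

lemma tot_computable_hd:
  "vec_computable n (Suc m) V \<Longrightarrow> tot_computable n (\<lambda>xs. hd (V xs))"
  by (rule tot_computable_cong[OF vec_computable_nth[of n "Suc m" V 0]])
    (auto simp: vec_computable_def intro!: hd_conv_nth[symmetric])

section \<open>Primitive recursion, case distinction and arithmetic\<close>

lemma tot_computable_Suc:
  assumes "tot_computable n A"
  shows "tot_computable n (\<lambda>xs. Suc (A xs))"
proof -
  have "tot_computable 1 (\<lambda>xs. Suc (hd xs))"
    unfolding tot_computable_def partial_computable_def by (rule exI[of _ Succ]) simp
  from tot_computable_comp[OF this vec_computable_single[OF assms]]
  show ?thesis by simp
qed

lemma tot_computable_const: "tot_computable n (\<lambda>xs. c)"
proof (induction c)
  case 0
  show ?case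
    unfolding tot_computable_def partial_computable_def by (rule exI[of _ Zero]) simp
qed (rule tot_computable_Suc)

text \<open>A form of \<open>PrimRec\<close> with a computed recursion bound \<open>K\<close> and
  with parameters kept intact: in the step, \<open>ys ! 0\<close> is the predecessor,
  \<open>ys ! 1\<close> the previous value and \<open>drop 2 ys\<close> the parameters.\<close>

lemma tot_computable_rec:
  assumes "tot_computable n B" "tot_computable n K"
    and "tot_computable (Suc (Suc n)) (\<lambda>ys. S (ys ! 0) (ys ! 1) (drop 2 ys))"
  shows "tot_computable n (\<lambda>xs. rec_nat (B xs) (\<lambda>k r. S k r xs) (K xs))"
proof -
  obtain b where b: "wf_recf n b" "\<And>xs. length xs = n \<Longrightarrow> eval_recf b xs = Some (B xs)"
    using assms(1) by (auto simp: tot_computable_def partial_computable_def)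
  obtain s where s: "wf_recf (Suc (Suc n)) s"
    "\<And>ys. length ys = Suc (Suc n) \<Longrightarrow> eval_recf s ys = Some (S (ys ! 0) (ys ! 1) (drop 2 ys))"
    using assms(3) by (auto simp: tot_computable_def partial_computable_def)
  have "rec_nat (eval_recf b xs) (\<lambda>k r. Option.bind r (\<lambda>y. eval_recf s (k # y # xs))) k
      = Some (rec_nat (B xs) (\<lambda>k r. S k r xs) k)" if "length xs = n" for xs k
    using that by (induction k) (simp_all add: b s)
  then have "tot_computable (Suc n) (\<lambda>ys. rec_nat (B (tl ys)) (\<lambda>k r. S k r (tl ys)) (hd ys))"
    unfolding tot_computable_def partial_computable_def
    by (intro exI[of _ "PrimRec b s"]) (simp add: b(1) s(1))
  moreover have "vec_computable n (Suc n) (\<lambda>xs. K xs # xs)"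
    by (intro vec_computable_Cons assms vec_computable_id)
  ultimately have "tot_computable n (\<lambda>xs. rec_nat (B (tl (K xs # xs)))
      (\<lambda>k r. S k r (tl (K xs # xs))) (hd (K xs # xs)))"
    by (rule tot_computable_comp)
  then show ?thesis by simp
qed

text \<open>Weakening: carries a function of the parameters into the step of a recursion, where two
  further arguments stand in front.\<close>

lemma tot_computable_drop:
  assumes "tot_computable n A"
  shows "tot_computable (Suc (Suc n)) (\<lambda>ys. A (drop 2 ys))"
  using tot_computable_comp[OF assms vec_computable_drop[of "Suc (Suc n)" 2]] vec_computable_id
  by simp

text \<open>A recursion whose step ignores the previous value distinguishes zero from nonzero. Both
  branches are total, so no divergence can leak in.\<close>

lemma tot_computable_if:
  assumes "tot_computable n C" "tot_computable n A" "tot_computable n B"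
  shows "tot_computable n (\<lambda>xs. if C xs = 0 then A xs else B xs)"
proof -
  have "rec_nat a (\<lambda>_ _. b) c = (if c = 0 then a else b)" for a b c :: nat
    by (cases c) auto
  moreover have "tot_computable n (\<lambda>xs. rec_nat (A xs) (\<lambda>_ _. B xs) (C xs))"
    by (intro tot_computable_rec assms tot_computable_drop[OF assms(3)])
  ultimately show ?thesis by (simp only:)
qed

lemma tot_computable_add:
  assumes "tot_computable n A" "tot_computable n B"
  shows "tot_computable n (\<lambda>xs. A xs + B xs)"
proof -
  have "rec_nat a (\<lambda>_ r. Suc r) b = a + b" for a b
    by (induction b) auto
  moreover have "tot_computable n (\<lambda>xs. rec_nat (A xs) (\<lambda>_ r. Suc r) (B xs))"
    by (intro tot_computable_rec assms tot_computable_Suc tot_computable_nth) simp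
  ultimately show ?thesis by (simp only:)
qed

lemma tot_computable_pred:
  assumes "tot_computable n A"
  shows "tot_computable n (\<lambda>xs. A xs - Suc 0)"
proof -
  have "rec_nat 0 (\<lambda>k _. k) a = a - Suc 0" for a
    by (cases a) auto
  moreover have "tot_computable n (\<lambda>xs. rec_nat 0 (\<lambda>k _. k) (A xs))"
    by (intro tot_computable_rec assms tot_computable_const tot_computable_nth) simp
  ultimately show ?thesis by (simp only:)
qed

lemma tot_computable_diff:
  assumes "tot_computable n A" "tot_computable n B"
  shows "tot_computable n (\<lambda>xs. A xs - B xs)"
proof -
  have "rec_nat a (\<lambda>_ r. r - Suc 0) b = a - b" for a b
    by (induction b) auto
  moreover have "tot_computable n (\<lambda>xs. rec_nat (A xs) (\<lambda>_ r. r - Suc 0) (B xs))"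
    by (intro tot_computable_rec assms tot_computable_pred tot_computable_nth) simp
  ultimately show ?thesis by (simp only:)
qed

section \<open>Sequencing and minimisation of partial functions\<close>

lemma partial_computable_bind:
  assumes "partial_computable n F" "partial_computable (Suc n) (\<lambda>ys. G (hd ys) (tl ys))"
  shows "partial_computable n (\<lambda>xs. Option.bind (F xs) (\<lambda>y. G y xs))"
proof -
  obtain f where f: "wf_recf n f" "\<And>xs. length xs = n \<Longrightarrow> eval_recf f xs = F xs"
    using assms(1) by (auto simp: partial_computable_def)
  obtain g where g: "wf_recf (Suc n) g"
    "\<And>ys. length ys = Suc n \<Longrightarrow> eval_recf g ys = G (hd ys) (tl ys)"
    using assms(2) by (auto simp: partial_computable_def)
  have "map (\<lambda>i. xs ! i) [0..<n] = xs" if "length xs = n" for xs :: "nat list"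
    using that map_nth by blast
  then show ?thesis
    unfolding partial_computable_def
    \<comment> \<open>The projections hand the original arguments on to \<open>g\<close>; strictness
      of \<open>Comp\<close> makes the whole undefined when \<open>f\<close> is.\<close>
    by (intro exI[of _ "Comp g (f # map Proj [0..<n])"])
      (auto simp: f g comp_def split: bind_splits)
qed

text \<open>Minimisation of a total function: the requirement of \<open>Mu\<close> that all earlier
  values be defined then holds automatically.\<close>

definition min_zero :: "(nat \<Rightarrow> nat) \<Rightarrow> nat option" where
  "min_zero F = (if \<exists>t. F t = 0 then Some (LEAST t. F t = 0) else None)"

lemma partial_computable_min_zero:
  assumes "tot_computable (Suc n) (\<lambda>ys. F (hd ys) (tl ys))"
  shows "partial_computable n (\<lambda>xs. min_zero (\<lambda>t. F t xs))"
proof -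
  obtain f where "wf_recf (Suc n) f"
    "\<And>ys. length ys = Suc n \<Longrightarrow> eval_recf f ys = Some (F (hd ys) (tl ys))"
    using assms by (auto simp: tot_computable_def partial_computable_def)
  then show ?thesis
    unfolding partial_computable_def min_zero_def
    by (intro exI[of _ "Mu f"]) (auto simp del: neq0_conv)
qed

section \<open>Decoding pairs\<close>

lemma tot_computable_triangle:
  assumes "tot_computable n A"
  shows "tot_computable n (\<lambda>xs. triangle (A xs))"
proof -
  have "rec_nat 0 (\<lambda>k r. r + Suc k) a = triangle a" for a
    by (induction a) simp_all
  moreover have "tot_computable n (\<lambda>xs. rec_nat 0 (\<lambda>k r. r + Suc k) (A xs))"
    by (intro tot_computable_rec assms tot_computable_const tot_computable_add tot_computable_Suc
        tot_computable_nth) simp_all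
  ultimately show ?thesis by (simp only:)
qed

lemma tot_computable_prod_encode:
  assumes "tot_computable n A" "tot_computable n B"
  shows "tot_computable n (\<lambda>xs. prod_encode (A xs, B xs))"
  unfolding prod_encode_def prod.case
  by (intro tot_computable_add tot_computable_triangle assms)

lemma triangle_mono: "m \<le> n \<Longrightarrow> triangle m \<le> triangle n"
  by (induction rule: dec_induct) auto

text \<open>The code of \<open>(a, b)\<close> is \<open>triangle (a + b) + a\<close>, so it lies at
  or above \<open>triangle (a + b)\<close> and below \<open>triangle (Suc (a + b))\<close>. The
  antidiagonal \<open>a + b\<close> is thus the first \<open>s\<close> whose next triangular number
  exceeds the code.\<close>

lemma min_zero_triangle:
  "min_zero (\<lambda>s. Suc (prod_encode (a, b)) - triangle (Suc s)) = Some (a + b)"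
proof -
  have least: "(LEAST s. Suc (prod_encode (a, b)) - triangle (Suc s) = 0) = a + b"
  proof (rule Least_equality)
    fix s assume s: "Suc (prod_encode (a, b)) - triangle (Suc s) = 0"
    show "a + b \<le> s"
    proof (rule ccontr)
      assume "\<not> a + b \<le> s"
      then have "triangle (Suc s) \<le> triangle (a + b)"
        by (intro triangle_mono) simp
      with s show False by (simp add: prod_encode_def)
    qed
  qed (simp add: prod_encode_def)
  moreover have "Suc (prod_encode (a, b)) - triangle (Suc (a + b)) = 0"
    by (simp add: prod_encode_def)
  ultimately show ?thesis unfolding min_zero_def by (metis (mono_tags, lifting))
qed

lemma tot_computable_prod_sum:
  assumes "tot_computable n A"
  shows "tot_computable n (\<lambda>xs. fst (prod_decode (A xs)) + snd (prod_decode (A xs)))"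
proof -
  have "partial_computable n (\<lambda>xs. min_zero (\<lambda>s. Suc (A xs) - triangle (Suc s)))"
    by (intro partial_computable_min_zero tot_computable_diff tot_computable_Suc
        tot_computable_triangle tot_computable_hd[OF vec_computable_id]
        tot_computable_comp[OF assms] vec_computable_tl vec_computable_id)
  moreover have "min_zero (\<lambda>s. Suc z - triangle (Suc s)) =
      Some (fst (prod_decode z) + snd (prod_decode z))" for z
    using min_zero_triangle[of "fst (prod_decode z)" "snd (prod_decode z)"] by simp
  ultimately show ?thesis
    by (simp add: tot_computable_def)
qed

text \<open>Once the antidiagonal is known, the first component is the offset of the code from its
  triangular number.\<close>

lemma tot_computable_fst_decode:
  assumes "tot_computable n A"
  shows "tot_computable n (\<lambda>xs. fst (prod_decode (A xs)))"
proof -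
  have "z - triangle (fst (prod_decode z) + snd (prod_decode z)) = fst (prod_decode z)" for z
    using prod_decode_inverse[of z] by (cases "prod_decode z") (auto simp: prod_encode_def)
  then show ?thesis
    using tot_computable_diff[OF assms tot_computable_triangle[OF tot_computable_prod_sum[OF assms]]]
    by simp
qed

lemma tot_computable_snd_decode:
  assumes "tot_computable n A"
  shows "tot_computable n (\<lambda>xs. snd (prod_decode (A xs)))"
  using tot_computable_diff[OF tot_computable_prod_sum tot_computable_fst_decode, OF assms assms]
  by simp

section \<open>Step-bounded evaluation\<close>

text \<open>
  The state of the search is \<open>0\<close> while every value seen so far encodes a positive result, \<open>1\<close> once
  an undefined value has been met, and \<open>n + 2\<close> once the zero \<open>n\<close> has been found. Values are encoded
  as in \<open>bounded_eval\<close>.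
\<close>

definition search :: "(nat \<Rightarrow> nat) \<Rightarrow> nat \<Rightarrow> nat" where
  "search F = rec_nat 0 (\<lambda>k s. if s = 0
     then if F k = 0 then 1 else if F k - Suc 0 = 0 then Suc (Suc k) else 0
     else s)"

text \<open>
  The value \<open>0\<close> means that no result has been obtained within the bound, and \<open>Suc y\<close> stands for
  the result \<open>y\<close>. The bound only limits the range of the unbounded searches.
\<close>

fun bounded_eval :: "recf \<Rightarrow> nat \<Rightarrow> nat list \<Rightarrow> nat" where
  "bounded_eval Zero t xs = 1"
| "bounded_eval Succ t xs = Suc (Suc (hd xs))"
| "bounded_eval (Proj i) t xs = Suc (xs ! i)"
| "bounded_eval (Comp f gs) t xs =
     (if \<forall>g\<in>set gs. bounded_eval g t xs \<noteq> 0
      then bounded_eval f t (map (\<lambda>g. bounded_eval g t xs - 1) gs) else 0)"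
| "bounded_eval (PrimRec f g) t xs =
     rec_nat (bounded_eval f t (tl xs))
       (\<lambda>k r. if r = 0 then 0 else bounded_eval g t (k # (r - 1) # tl xs)) (hd xs)"
| "bounded_eval (Mu f) t xs = search (\<lambda>n. bounded_eval f t (n # xs)) t - 1"

section \<open>Soundness and completeness of the step-bounded evaluation\<close>

lemma search_eq_0_iff: "search F k = 0 \<longleftrightarrow> (\<forall>m<k. 1 < F m)"
  by (induction k) (auto simp: search_def less_Suc_eq)

text \<open>Nonzero states are absorbing, so state \<open>n + 2\<close> can only be entered at stage
  \<open>n\<close>, coming from state \<open>0\<close>. The value \<open>1\<close> of
  \<open>F\<close> encodes the result \<open>0\<close>.\<close>

lemma search_eq_Suc_Suc_iff:
  "search F k = Suc (Suc n) \<longleftrightarrow> n < k \<and> F n = 1 \<and> (\<forall>m<n. 1 < F m)"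
proof (induction k)
  case (Suc k)
  have "search F (Suc k) = (if search F k = 0
     then if F k = 0 then 1 else if F k - Suc 0 = 0 then Suc (Suc k) else 0
     else search F k)"
    by (simp add: search_def)
  with Suc show ?case
    using search_eq_0_iff[of F k] by (auto simp: less_Suc_eq)
qed (simp add: search_def)

lemma bounded_eval_sound: "bounded_eval f t xs = Suc y \<Longrightarrow> eval_recf f xs = Some y"
proof (induction f arbitrary: xs y)
  case (Comp f gs)
  have nz: "\<forall>g\<in>set gs. bounded_eval g t xs \<noteq> 0"
    using Comp.prems by (auto split: if_splits)
  then have g: "eval_recf g xs = Some (bounded_eval g t xs - 1)" if "g \<in> set gs" for g
    using Comp.IH(2)[OF that, of xs "bounded_eval g t xs - 1"] that by auto
  have "eval_recf f (map (\<lambda>g. bounded_eval g t xs - 1) gs) = Some y"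
    using Comp.prems nz by (intro Comp.IH(1)) (auto split: if_splits)
  with g show ?case by (simp cong: map_cong)
next
  case (PrimRec f g)
  define R where "R = rec_nat (bounded_eval f t (tl xs))
       (\<lambda>k r. if r = 0 then 0 else bounded_eval g t (k # (r - 1) # tl xs))"
  \<comment> \<open>The recursion argument is replaced by a free \<open>k\<close>, so that an inner
    induction can follow the recursion while the parameters stay fixed.\<close>
  have "R k = Suc y \<Longrightarrow> rec_nat (eval_recf f (tl xs))
       (\<lambda>k r. Option.bind r (\<lambda>y. eval_recf g (k # y # tl xs))) k = Some y" for k y
  proof (induction k arbitrary: y)
    case 0
    then show ?case using PrimRec.IH(1) by (simp add: R_def)
  next
    case (Suc k)
    then obtain z where "R k = Suc z"
      by (cases "R k") (auto simp: R_def)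
    with Suc show ?case using PrimRec.IH(2) by (simp add: R_def)
  qed
  with PrimRec.prems show ?case by (simp add: R_def)
next
  case (Mu f)
  then have "search (\<lambda>n. bounded_eval f t (n # xs)) t = Suc (Suc y)"
    by auto
  then have y: "bounded_eval f t (y # xs) = 1" and m: "\<forall>m<y. 1 < bounded_eval f t (m # xs)"
    by (auto simp: search_eq_Suc_Suc_iff)
  have "eval_recf f (y # xs) = Some 0"
    using y by (intro Mu.IH) simp
  moreover have m': "\<exists>v>0. eval_recf f (m # xs) = Some v" if "m < y" for m
    using m that Mu.IH[of "m # xs" "bounded_eval f t (m # xs) - 1"]
    by (intro exI[of _ "bounded_eval f t (m # xs) - 1"]) auto
  moreover have "(LEAST n. eval_recf f (n # xs) = Some 0) = y"
  proof (rule Least_equality)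
    fix n assume "eval_recf f (n # xs) = Some 0"
    then show "y \<le> n" using m'[of n] by (cases "n < y") auto
  qed fact
  ultimately show ?case by fastforce
qed auto

text \<open>A converging computation has only finitely many subcomputations. Stating success for all
  sufficiently large bounds lets their bounds be merged, as this property is closed under finite
  conjunction; monotonicity in the bound is never argued.\<close>

lemma bounded_eval_complete:
  "eval_recf f xs = Some y \<Longrightarrow> \<forall>\<^sub>F t in sequentially. bounded_eval f t xs = Suc y"
proof (induction f arbitrary: xs y)
  case (Comp f gs)
  have def: "\<forall>g\<in>set gs. eval_recf g xs \<noteq> None"
    using Comp.prems by (auto split: if_splits)
  then have "\<forall>\<^sub>F t in sequentially. \<forall>g\<in>set gs. bounded_eval g t xs = Suc (the (eval_recf g xs))"
    using Comp.IH(2) by (intro eventually_ball_finite) auto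
  moreover have "\<forall>\<^sub>F t in sequentially.
      bounded_eval f t (map (\<lambda>g. the (eval_recf g xs)) gs) = Suc y"
    using Comp.prems by (intro Comp.IH(1)) (auto split: if_splits)
  ultimately show ?case
  proof eventually_elim
    case (elim t)
    then show ?case by (simp cong: map_cong)
  qed
next
  case (PrimRec f g)
  define R where "R = rec_nat (eval_recf f (tl xs))
       (\<lambda>k r. Option.bind r (\<lambda>y. eval_recf g (k # y # tl xs)))"
  have "R k = Some y \<Longrightarrow> \<forall>\<^sub>F t in sequentially. rec_nat (bounded_eval f t (tl xs))
       (\<lambda>k r. if r = 0 then 0 else bounded_eval g t (k # (r - 1) # tl xs)) k = Suc y" for k y
  proof (induction k arbitrary: y)
    case 0
    then show ?case using PrimRec.IH(1) by (simp add: R_def)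
  next
    case (Suc k)
    then obtain z where z: "R k = Some z" "eval_recf g (k # z # tl xs) = Some y"
      by (cases "R k") (auto simp: R_def)
    from Suc.IH[OF z(1)] PrimRec.IH(2)[OF z(2)] show ?case
      by eventually_elim simp
  qed
  with PrimRec.prems show ?case by (simp add: R_def)
next
  case (Mu f)
  from Mu.prems obtain n where n: "eval_recf f (n # xs) = Some 0"
      "\<forall>m<n. eval_recf f (m # xs) \<noteq> None" and y: "y = (LEAST n. eval_recf f (n # xs) = Some 0)"
    by (auto split: if_splits)
  have y0: "eval_recf f (y # xs) = Some 0"
    unfolding y by (rule LeastI[of _ n]) (rule n)
  have "y \<le> n"
    unfolding y by (rule Least_le) (rule n)
  \<comment> \<open>Values below \<open>y\<close> are defined because \<open>y \<le> n\<close>, and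
    nonzero by minimality of \<open>y\<close>.\<close>
  have less: "\<exists>v>0. eval_recf f (m # xs) = Some v" if "m < y" for m
    using n(2) not_less_Least[of m "\<lambda>n. eval_recf f (n # xs) = Some 0"] that \<open>y \<le> n\<close>
    unfolding y[symmetric] by (metis bot_nat_0.not_eq_extremum not_None_eq order_less_le_trans)
  have "\<forall>\<^sub>F t in sequentially. \<forall>m\<in>{..<y}. 1 < bounded_eval f t (m # xs)"
  proof (intro eventually_ball_finite ballI)
    fix m assume "m \<in> {..<y}"
    then obtain v where "v > 0" "eval_recf f (m # xs) = Some v"
      using less by auto
    from Mu.IH[OF this(2)] show "\<forall>\<^sub>F t in sequentially. 1 < bounded_eval f t (m # xs)"
      by eventually_elim (use \<open>v > 0\<close> in simp)
  qed simp
  \<comment> \<open>The bound must also exceed \<open>y\<close>, since the search with bound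
    \<open>t\<close> inspects only candidates below \<open>t\<close>.\<close>
  moreover note Mu.IH[OF y0] eventually_gt_at_top[of y]
  ultimately show ?case
  proof eventually_elim
    case (elim t)
    then have "search (\<lambda>n. bounded_eval f t (n # xs)) t = Suc (Suc y)"
      by (simp add: search_eq_Suc_Suc_iff)
    then show ?case by simp
  qed
qed auto

text \<open>Convergence becomes an existential statement about stages, which is what permits
  searching two computations in parallel.\<close>

lemma eval_recf_defined_iff:
  "eval_recf f xs \<noteq> None \<longleftrightarrow> (\<exists>t. bounded_eval f t xs \<noteq> 0)"
proof
  assume "eval_recf f xs \<noteq> None"
  then obtain y where "eval_recf f xs = Some y" by auto
  then obtain t where "bounded_eval f t xs = Suc y"
    using eventually_happens'[OF sequentially_bot bounded_eval_complete] by blast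
  then show "\<exists>t. bounded_eval f t xs \<noteq> 0"
    by (intro exI[of _ t]) simp
next
  assume "\<exists>t. bounded_eval f t xs \<noteq> 0"
  then show "eval_recf f xs \<noteq> None"
    using bounded_eval_sound by (metis not0_implies_Suc option.discI)
qed

section \<open>Computability of the step-bounded evaluation\<close>

lemma tot_computable_if_all:
  assumes "\<And>g. g \<in> set gs \<Longrightarrow> tot_computable n (H g)" "tot_computable n A"
  shows "tot_computable n (\<lambda>xs. if \<forall>g\<in>set gs. H g xs \<noteq> 0 then A xs else 0)"
  using assms(1)
proof (induction gs)
  case Nil
  show ?case using assms(2) by simp
next
  case (Cons g gs)
  \<comment> \<open>The list of expressions is fixed, so the quantifier over it unfolds into nested
    case distinctions.\<close>
  have "tot_computable n (\<lambda>xs. if H g xs = 0 then 0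
      else if \<forall>g\<in>set gs. H g xs \<noteq> 0 then A xs else 0)"
    by (intro tot_computable_if tot_computable_const Cons) (use Cons.prems in auto)
  then show ?case by (rule tot_computable_cong) auto
qed

text \<open>Bound and arguments are arbitrary computable functions because subexpressions are
  evaluated at changed argument lists, and for \<open>PrimRec\<close> and \<open>Mu\<close> in a
  context with two extra variables.\<close>

lemma tot_computable_bounded_eval:
  assumes "wf_recf n f" "tot_computable m T" "vec_computable m n V"
  shows "tot_computable m (\<lambda>xs. bounded_eval f (T xs) (V xs))"
  using assms
proof (induction f arbitrary: n m T V)
  case Zero
  show ?case by (simp add: tot_computable_const)
next
  case Succ
  then show ?case using tot_computable_hd[of m 0 V] by (simp add: tot_computable_Suc)
next
  case (Proj i)
  then show ?case using vec_computable_nth[of m n V i] by (simp add: tot_computable_Suc)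
next
  case (Comp f gs)
  have g: "tot_computable m (\<lambda>xs. bounded_eval g (T xs) (V xs))" if "g \<in> set gs" for g
    using Comp that by auto
  have "vec_computable m (length gs) (\<lambda>xs. map (\<lambda>g. bounded_eval g (T xs) (V xs) - Suc 0) gs)"
    by (intro vec_computable_map tot_computable_pred g)
  then have f: "tot_computable m (\<lambda>xs. bounded_eval f (T xs)
      (map (\<lambda>g. bounded_eval g (T xs) (V xs) - Suc 0) gs))"
    using Comp.prems by (intro Comp.IH(1)) simp_all
  show ?case
    unfolding bounded_eval.simps One_nat_def by (intro tot_computable_if_all g f)
next
  case (PrimRec f g)
  then obtain n' where n: "n = Suc n'" by (cases n) auto
  have V: "vec_computable (Suc (Suc m)) n (\<lambda>ys. V (drop 2 ys))"
    using PrimRec.prems(3) by (auto simp: vec_computable_def intro: tot_computable_drop)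
  note T = tot_computable_drop[OF PrimRec.prems(2)]
  have wf: "wf_recf n' f" "wf_recf (Suc (Suc n')) g"
    using PrimRec.prems(1) by (simp_all add: n)
  have "tot_computable m (\<lambda>xs. rec_nat (bounded_eval f (T xs) (tl (V xs)))
       (\<lambda>k r. if r = 0 then 0 else bounded_eval g (T xs) (k # (r - Suc 0) # tl (V xs)))
       (hd (V xs)))"
    by (intro tot_computable_rec tot_computable_if tot_computable_const PrimRec.IH(1)[OF wf(1)]
        PrimRec.IH(2)[OF wf(2)] vec_computable_Cons tot_computable_pred tot_computable_nth T
        PrimRec.prems(2) vec_computable_tl V[unfolded n]
        tot_computable_hd[OF PrimRec.prems(3)[unfolded n]] PrimRec.prems(3)[unfolded n]) simp_all
  then show ?case by (simp only: bounded_eval.simps One_nat_def)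
next
  case (Mu f)
  have V: "vec_computable (Suc (Suc m)) n (\<lambda>ys. V (drop 2 ys))"
    using Mu.prems(3) by (auto simp: vec_computable_def intro: tot_computable_drop)
  \<comment> \<open>The search is itself a primitive recursion; its counter \<open>ys ! 0\<close> is
    the candidate passed to \<open>f\<close>, while \<open>ys ! 1\<close> holds the state.\<close>
  have f: "tot_computable (Suc (Suc m))
      (\<lambda>ys. bounded_eval f (T (drop 2 ys)) (ys ! 0 # V (drop 2 ys)))"
    using Mu.prems(1)
    by (intro Mu.IH[where n = "Suc n"] vec_computable_Cons tot_computable_nth V
        tot_computable_drop[OF Mu.prems(2)]) simp_all
  have "tot_computable m (\<lambda>xs. search (\<lambda>n. bounded_eval f (T xs) (n # V xs)) (T xs) - Suc 0)"
    unfolding search_def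
    by (intro tot_computable_pred tot_computable_rec tot_computable_if tot_computable_const
        tot_computable_Suc tot_computable_nth f Mu.prems(2)) simp_all
  then show ?case by simp
qed

section \<open>The recursion theorem and effective inseparability\<close>

lemma total_computable1_comp:
  "total_computable1 s \<Longrightarrow> tot_computable n A \<Longrightarrow> tot_computable n (\<lambda>xs. s (A xs))"
  using tot_computable_comp[of 1 "\<lambda>xs. s (xs ! 0)" n "\<lambda>xs. [A xs]"] vec_computable_single[of n A]
  by (simp add: total_computable1_def partial_computable1_def tot_computable_def)

lemma partial_computable2_comp:
  assumes "partial_computable2 \<psi>" "tot_computable n A" "tot_computable n B"
  shows "partial_computable n (\<lambda>xs. \<psi> (A xs) (B xs))"
proof -
  have "vec_computable n 2 (\<lambda>xs. [A xs, B xs])"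
    unfolding numeral_2_eq_2 by (intro vec_computable_Cons vec_computable_Nil assms)
  from partial_computable_comp[OF assms(1)[unfolded partial_computable2_def] this]
  show ?thesis by simp
qed

text \<open>
  The self-reference comes from coding into the argument of the s-m-n function an index of that
  function itself.
\<close>

lemma recursion_theorem:
  assumes "acceptable_numbering \<phi>" "partial_computable 2 (\<lambda>xs. D (xs ! 0) (xs ! 1))"
  obtains h where "total_computable1 h" "\<And>z. \<phi> (h z) 0 = D z (h z)"
proof -
  \<comment> \<open>Index and parameter are both coded in \<open>c\<close>, and the index is run on
    \<open>c\<close> itself to produce \<open>p\<close>. The input \<open>y\<close> is ignored, as
    only the value at \<open>0\<close> matters.\<close>
  define \<psi> where "\<psi> c y =
    Option.bind (\<phi> (fst (prod_decode c)) c) (\<lambda>p. D (snd (prod_decode c)) p)" for c and y :: nat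
  have U: "partial_computable2 \<phi>"
    using assms(1) by (simp add: acceptable_numbering_def)
  have tl: "vec_computable (Suc 2) 2 tl" and hd: "tot_computable (Suc 2) hd"
    by (rule vec_computable_tl[OF vec_computable_id], rule tot_computable_hd[OF vec_computable_id])
  have D: "partial_computable (Suc 2) (\<lambda>ys. D (snd (prod_decode (tl ys ! 0))) (hd ys))"
    using assms(2)
    by (intro partial_computable2_comp[where \<psi> = D] tot_computable_snd_decode
        vec_computable_nth[OF tl] hd) (simp_all add: partial_computable2_def)
  have "partial_computable2 \<psi>"
    unfolding partial_computable2_def \<psi>_def
    by (intro partial_computable_bind partial_computable2_comp[OF U] tot_computable_fst_decode
        tot_computable_nth D) simp_all
  then obtain s where s: "total_computable1 s" "\<And>c. \<phi> (s c) = \<psi> c"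
    using assms(1) by (auto simp: acceptable_numbering_def)
  then have "(\<lambda>x. Some (s x)) \<in> range \<phi>"
    using assms(1) by (simp add: acceptable_numbering_def total_computable1_def)
  \<comment> \<open>With an index \<open>v\<close> of \<open>s\<close> coded in \<open>c\<close>,
    the inner call returns \<open>s c\<close>, the number of the very program being run.\<close>
  then obtain v where v: "\<phi> v = (\<lambda>x. Some (s x))"
    by (metis imageE)
  show thesis
  proof (rule that)
    have "tot_computable 1 (\<lambda>xs. s (prod_encode (v, xs ! 0)))"
      by (intro total_computable1_comp[OF s(1)] tot_computable_prod_encode tot_computable_const
          tot_computable_nth) simp
    then show "total_computable1 (\<lambda>z. s (prod_encode (v, z)))"
      by (simp add: total_computable1_def partial_computable1_def tot_computable_def)
    show "\<phi> (s (prod_encode (v, z))) 0 = D z (s (prod_encode (v, z)))" for z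
      by (simp add: s(2) \<psi>_def v)
  qed
qed

text \<open>A parallel search finds a stage at which \<open>p\<close> shows up in one of the two
  sets, and disjointness ensures that the set is identified correctly. The indices are coded as a
  pair because the recursion theorem carries a single parameter.\<close>

lemma separating_function:
  assumes "partial_computable2 \<phi>"
  obtains D where "partial_computable 2 (\<lambda>xs. D (xs ! 0) (xs ! 1))"
    "\<And>i j p. W \<phi> i \<inter> W \<phi> j = {} \<Longrightarrow> p \<in> W \<phi> i \<Longrightarrow> D (prod_encode (i, j)) p = Some 0"
    "\<And>i j p. W \<phi> i \<inter> W \<phi> j = {} \<Longrightarrow> p \<in> W \<phi> j \<Longrightarrow> D (prod_encode (i, j)) p = Some 1"
proof -
  obtain u where u: "wf_recf 2 u" "\<And>xs. length xs = 2 \<Longrightarrow> eval_recf u xs = \<phi> (xs ! 0) (xs ! 1)"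
    using assms by (auto simp: partial_computable2_def partial_computable_def)
  define T where "T e p t = bounded_eval u t [e, p]" for e p t
  have W_iff: "p \<in> W \<phi> e \<longleftrightarrow> (\<exists>t. T e p t \<noteq> 0)" for e p
    using eval_recf_defined_iff[of u "[e, p]"] by (simp add: u(2) W_def T_def dom_def)
  \<comment> \<open>Truncated subtraction gives zero exactly when at least one of the two
    computations has a result at stage \<open>t\<close>.\<close>
  define S where "S i j p = min_zero (\<lambda>t. 1 - (T i p t + T j p t))" for i j p
  define D where "D z p = Option.bind (S (fst (prod_decode z)) (snd (prod_decode z)) p)
      (\<lambda>t. Some (1 - T (fst (prod_decode z)) p t))" for z p
  have T: "tot_computable n (\<lambda>xs. T (E xs) (P xs) (N xs))"
    if "tot_computable n E" "tot_computable n P" "tot_computable n N" for n E P N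
    unfolding T_def using u(1) unfolding numeral_2_eq_2
    by (rule tot_computable_bounded_eval) (intro vec_computable_Cons vec_computable_Nil that)+
  have tl: "vec_computable (Suc 2) 2 tl" and hd: "tot_computable (Suc 2) hd"
    by (rule vec_computable_tl[OF vec_computable_id], rule tot_computable_hd[OF vec_computable_id])
  have nth: "tot_computable (Suc 2) (\<lambda>ys. tl ys ! 0)" "tot_computable (Suc 2) (\<lambda>ys. tl ys ! 1)"
    by (rule vec_computable_nth[OF tl], simp)+
  have search: "partial_computable 2
      (\<lambda>xs. S (fst (prod_decode (xs ! 0))) (snd (prod_decode (xs ! 0))) (xs ! 1))"
    unfolding S_def
    by (intro partial_computable_min_zero tot_computable_diff tot_computable_add
        tot_computable_const T tot_computable_fst_decode tot_computable_snd_decode nth hd)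
  have out: "tot_computable (Suc 2)
      (\<lambda>ys. 1 - T (fst (prod_decode (tl ys ! 0))) (tl ys ! 1) (hd ys))"
    by (intro tot_computable_diff tot_computable_const T tot_computable_fst_decode nth hd)
  have D: "partial_computable 2 (\<lambda>xs. D (xs ! 0) (xs ! 1))"
    unfolding D_def
    by (rule partial_computable_bind) (rule search, rule out[unfolded tot_computable_def])
  have S: "\<exists>t. S i j p = Some t \<and> T i p t + T j p t \<noteq> 0"
    if "p \<in> W \<phi> i \<union> W \<phi> j" for i j p
  proof -
    have ex: "\<exists>t. 1 - (T i p t + T j p t) = 0"
    proof -
      from that obtain t where "T i p t + T j p t \<noteq> 0"
        by (auto simp: W_iff)
      then show ?thesis by (intro exI[of _ t]) (simp add: Suc_le_eq)
    qed
    define t where "t = (LEAST t. 1 - (T i p t + T j p t) = 0)"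
    have "1 - (T i p t + T j p t) = 0"
      unfolding t_def by (rule LeastI_ex[OF ex])
    then have "T i p t + T j p t \<noteq> 0" by linarith
    moreover have "S i j p = Some t"
      unfolding S_def min_zero_def t_def by (rule if_P[OF ex])
    ultimately show ?thesis by blast
  qed
  have D0: "D (prod_encode (i, j)) p = Some 0"
    if "W \<phi> i \<inter> W \<phi> j = {}" "p \<in> W \<phi> i" for i j p
  proof -
    \<comment> \<open>By disjointness the other computation never halts, so the stage found must be
      due to \<open>W \<phi> i\<close>.\<close>
    have "T j p t = 0" for t using that W_iff[of p j] by auto
    with S[of p i j] that show ?thesis by (auto simp: D_def)
  qed
  have D1: "D (prod_encode (i, j)) p = Some 1"
    if "W \<phi> i \<inter> W \<phi> j = {}" "p \<in> W \<phi> j" for i j p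
  proof -
    have "T i p t = 0" for t using that W_iff[of p i] by auto
    with S[of p i j] that show ?thesis by (auto simp: D_def)
  qed
  show thesis by (rule that[OF D D0 D1])
qed

theorem theorem7p5:
  fixes \<phi> :: "nat \<Rightarrow> nat \<Rightarrow> nat option"
  assumes "acceptable_numbering \<phi>"
  shows "effectively_inseparable \<phi> (M_set \<phi>) (E0_set \<phi>)"
proof (rule separating_function)
  show "partial_computable2 \<phi>"
    using assms by (simp add: acceptable_numbering_def)
next
  fix D
  assume D: "partial_computable 2 (\<lambda>xs. D (xs ! 0) (xs ! 1))"
    "\<And>i j p. W \<phi> i \<inter> W \<phi> j = {} \<Longrightarrow> p \<in> W \<phi> i \<Longrightarrow> D (prod_encode (i, j)) p = Some 0"
    "\<And>i j p. W \<phi> i \<inter> W \<phi> j = {} \<Longrightarrow> p \<in> W \<phi> j \<Longrightarrow> D (prod_encode (i, j)) p = Some 1"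
  obtain h where h: "total_computable1 h" "\<And>z. \<phi> (h z) 0 = D z (h z)"
    using recursion_theorem[OF assms D(1)] by blast
  have "tot_computable 2 (\<lambda>xs. h (prod_encode (xs ! 0, xs ! 1)))"
    by (intro total_computable1_comp[OF h(1)] tot_computable_prod_encode tot_computable_nth) simp_all
  then have "total_computable2 (\<lambda>i j. h (prod_encode (i, j)))"
    by (simp add: total_computable2_def partial_computable2_def tot_computable_def)
  moreover have "h (prod_encode (i, j)) \<notin> W \<phi> i \<union> W \<phi> j"
    if sub: "M_set \<phi> \<subseteq> W \<phi> i" "E0_set \<phi> \<subseteq> W \<phi> j" and disj: "W \<phi> i \<inter> W \<phi> j = {}" for i j
  proof
    let ?p = "h (prod_encode (i, j))"
    assume "?p \<in> W \<phi> i \<union> W \<phi> j"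
    then consider "?p \<in> W \<phi> i" | "?p \<in> W \<phi> j" by blast
    then show False
    proof cases
      case 1
      then have "?p \<in> E0_set \<phi>" using D(2)[OF disj] h(2) by (simp add: E0_set_def)
      with 1 sub disj show False by blast
    next
      case 2
      then have "?p \<in> M_set \<phi>" using D(3)[OF disj] h(2) by (simp add: M_set_def)
      with 2 sub disj show False by blast
    qed
  qed
  ultimately show ?thesis
    unfolding effectively_inseparable_def by blast
qed

end
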